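(* There exist a matrix $A\in\mathrm{GL}_2(\mathbb{R})$ with $\|A\|<1$ that is not diagonalizable over $\mathbb{R}$, and a set $U\subset\mathbb{R}^2$ of full Lebesgue measure, such that for each $b\in U$ the map $f_{A,b}\colon[0,1)^2\to[0,1)^2$, $f_{A,b}(x)=Ax+b\pmod{\mathbb{Z}^2}$, is not $C^1$ conjugate to the product of one-dimensional contracted rotations.
   Context: For $x\in\mathbb{R}^d$, $\|x\|=\max_j|x_j|$, and $\|A\|=\sup_{x\ne0}\|Ax\|/\|x\|$. Explicitly, $f_{A,b}(x)=Ax+b-\lfloor Ax+b\rfloor$ with the component-wise floor function. A one-dimensional contracted rotation is a map $g\colon[0,1)\to[0,1)$ of the form $g(x)=\lambda x+c\pmod 1$ with $\lambda\in\mathbb{R}$, $0<|\lambda|<1$, and $c\in\mathbb{R}$. The map $f_{A,b}$ is $C^1$ conjugate to the product of one-dimensional contracted rotations if there exist a $C^1$ diffeomorphism $h\colon[0,1)^2\to[0,1)^2$ and one-dimensional contracted rotations $g_1,g_2$ such that $(h\circ f_{A,b}\circ h^{-1})(y_1,y_2)=(g_1(y_1),g_2(y_2))$ for all $(y_1,y_2)\in[0,1)^2$. *)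

theory Defs
  imports "HOL-Analysis.Analysis"
begin

text \<open>On \<^typ>\<open>real^'n\<close> the library's \<^const>\<open>infnorm\<close> is the maximum norm
  of the coordinates; the operator norm below is the one induced by it (whereas
  \<^const>\<open>onorm\<close> is induced by the Euclidean norm).\<close>

definition inf_opnorm :: "real^'n^'n \<Rightarrow> real" where
  "inf_opnorm A = (SUP x\<in>-{0}. infnorm (A *v x) / infnorm x)"

definition diagonalizable :: "real^'n^'n \<Rightarrow> bool" where
  "diagonalizable A \<longleftrightarrow>
     (\<exists>(P :: real^'n^'n) (D :: real^'n^'n).
        invertible P \<and> (\<forall>i j. i \<noteq> j \<longrightarrow> D $ i $ j = 0) \<and> A = P ** D ** matrix_inv P)"

definition unit_cube :: "(real^'n) set" where
  "unit_cube = {x. \<forall>i. x $ i \<in> {0..<1}}"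

definition affine_mod1 :: "real^'n^'n \<Rightarrow> real^'n \<Rightarrow> real^'n \<Rightarrow> real^'n" where
  "affine_mod1 A b x = (\<chi> i. (A *v x + b) $ i - of_int \<lfloor>(A *v x + b) $ i\<rfloor>)"

text \<open>Only the values of \<open>g\<close> on the half-open interval are constrained.\<close>

definition contracted_rotation :: "(real \<Rightarrow> real) \<Rightarrow> bool" where
  "contracted_rotation g \<longleftrightarrow>
     (\<exists>l c. 0 < \<bar>l\<bar> \<and> \<bar>l\<bar> < 1 \<and> (\<forall>x\<in>{0..<1}. g x = frac (l * x + c)))"

text \<open>The set \<open>S\<close> need not be open: derivatives are taken within \<open>S\<close>, hence are one-sided at
  boundary points belonging to \<open>S\<close>. For \<open>S = unit_cube\<close> such a derivative is unique.\<close>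

definition C1_on :: "'a::real_normed_vector set \<Rightarrow> ('a \<Rightarrow> 'b::real_normed_vector) \<Rightarrow> bool" where
  "C1_on S h \<longleftrightarrow>
     (\<exists>h' :: 'a \<Rightarrow> 'a \<Rightarrow>\<^sub>L 'b.
        (\<forall>x\<in>S. (h has_derivative blinfun_apply (h' x)) (at x within S)) \<and> continuous_on S h')"

definition C1_diffeomorphism ::
  "'a::real_normed_vector set \<Rightarrow> 'b::real_normed_vector set \<Rightarrow> ('a \<Rightarrow> 'b) \<Rightarrow> bool" where
  "C1_diffeomorphism S T h \<longleftrightarrow> bij_betw h S T \<and> C1_on S h \<and> C1_on T (inv_into S h)"

definition C1_conjugate_to_rotation_product :: "(real^2 \<Rightarrow> real^2) \<Rightarrow> bool" where
  "C1_conjugate_to_rotation_product f \<longleftrightarrow>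
     (\<exists>(h :: real^2 \<Rightarrow> real^2) g1 g2.
        C1_diffeomorphism unit_cube unit_cube h \<and>
        contracted_rotation g1 \<and> contracted_rotation g2 \<and>
        (\<forall>y\<in>unit_cube. h (f (inv_into unit_cube h y)) = vector [g1 (y $ 1), g2 (y $ 2)]))"

end

theory Submission imports Defs begin

text \<open>Take for \<open>A\<close> the Jordan block with negative eigenvalue \<open>-1/4\<close>. Solving \<open>x = A x + b - m\<close>
  by back substitution, the coordinates are \<open>4/5\<close> times numbers that the integer vector \<open>m\<close> can
  move into \<open>]0,1]\<close>; so for every \<open>b\<close> the map has a fixed point in the open square, with
  derivative \<open>A\<close>. A \<open>C\<^sup>1\<close> conjugacy to a product map turns this derivative into a diagonal
  matrix, although \<open>A\<close> is not diagonalizable.\<close>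

section \<open>Derivatives at an interior fixed point and under conjugacy\<close>

lemma interior_unit_cubeI:
  fixes p :: "real^'n"
  assumes "\<And>i. 0 < p $ i" "\<And>i. p $ i < 1"
  shows "p \<in> interior unit_cube"
proof -
  have "p \<in> box 0 (\<chi> i. 1)"
    using assms by (simp add: mem_box_cart)
  moreover have "box 0 (\<chi> i. 1) \<subseteq> (unit_cube :: (real^'n) set)"
    by (auto simp: mem_box_cart unit_cube_def less_imp_le)
  ultimately show ?thesis
    by (meson interiorI open_box)
qed

lemma affine_mod1_in_unit_cube: "affine_mod1 A b x \<in> unit_cube"
  by (auto simp: affine_mod1_def unit_cube_def) linarith+

text \<open>The affine map shifted by the integer vector \<open>m\<close> fixes \<open>p\<close>. By
  continuity it keeps points near \<open>p\<close> inside the cube, so the integer parts are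
  constantly \<open>m\<close> there and the reduced map coincides locally with this shifted affine
  map.\<close>

lemma affine_mod1_has_derivative_at_fixed_point:
  fixes A :: "real^'n^'n"
  assumes p: "p \<in> interior unit_cube" and m: "\<And>i. (A *v p + b) $ i = p $ i + of_int (m i)"
  shows "affine_mod1 A b p = p" and "(affine_mod1 A b has_derivative (*v) A) (at p)"
proof -
  have mod1: "affine_mod1 A b x = A *v x + b - (\<chi> i. of_int (m i))"
    if "A *v x + b - (\<chi> i. of_int (m i)) \<in> unit_cube" for x
  proof -
    have "\<lfloor>(A *v x + b) $ i\<rfloor> = m i" for i
      using that by (intro floor_unique) (auto simp: unit_cube_def algebra_simps dest: spec[of _ i])
    then show ?thesis
      by (auto simp: affine_mod1_def vec_eq_iff)
  qed
  have fix_p: "A *v p + b - (\<chi> i. of_int (m i)) = p"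
    using m by (auto simp: vec_eq_iff)
  then show "affine_mod1 A b p = p"
    using p mod1 interior_subset by (metis subsetD)
  let ?g = "\<lambda>x. A *v x + b - (\<chi> i. of_int (m i))"
  have deriv: "(?g has_derivative (*v) A) (at p)"
    by (auto intro!: derivative_eq_intros bounded_linear_imp_has_derivative
        matrix_vector_mul_bounded_linear)
  then have "isCont ?g p"
    by (rule has_derivative_continuous)
  then have "(?g \<longlongrightarrow> p) (at p)"
    using fix_p by (simp add: isCont_def)
  then have "\<forall>\<^sub>F x in at p. ?g x \<in> interior unit_cube"
    using p by (intro topological_tendstoD) auto
  then have "\<forall>\<^sub>F x in at p. ?g x = affine_mod1 A b x"
    by eventually_elim (use mod1 interior_subset in \<open>metis subsetD\<close>)
  moreover have "?g p = affine_mod1 A b p"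
    using fix_p \<open>affine_mod1 A b p = p\<close> by simp
  ultimately show "(affine_mod1 A b has_derivative (*v) A) (at p)"
    using deriv by (blast intro: has_derivative_transform_eventually[where s = UNIV])
qed

text \<open>Moving only coordinate \<open>j\<close> leaves component \<open>i\<close> of the product
  map constant. The point \<open>q\<close> may lie on a lower face of the cube, so the segment from
  \<open>q\<close> runs only in the positive direction; it stays in the half-open cube for
  parameters below \<open>1 - q $ j\<close>.\<close>

lemma diagonal_derivative_of_product_map:
  fixes q :: "real^'n"
  assumes q: "q \<in> unit_cube"
    and deriv: "((\<lambda>y. \<chi> i. g i (y $ i)) has_derivative D) (at q within unit_cube)"
    and "i \<noteq> j"
  shows "D (axis j 1) $ i = 0"
proof -
  define S where "S = {0..<1 - q $ j}"
  let ?c = "\<lambda>t. q + t *\<^sub>R axis j 1"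
  let ?G = "\<lambda>y. \<chi> i. g i (y $ i)"
  have pos: "0 < 1 - q $ j"
    using q by (simp add: unit_cube_def)
  have c_in: "?c ` S \<subseteq> unit_cube"
    using q by (auto simp: S_def unit_cube_def axis_def)
  have "(?c has_derivative (\<lambda>t. t *\<^sub>R axis j 1)) (at 0 within S)"
    by (auto intro!: derivative_eq_intros)
  moreover have "(?G has_derivative D) (at (?c 0) within ?c ` S)"
    using has_derivative_subset[OF deriv c_in] by simp
  ultimately have "((?G \<circ> ?c) has_derivative (D \<circ> (\<lambda>t. t *\<^sub>R axis j 1))) (at 0 within S)"
    by (rule diff_chain_within)
  then have "((\<lambda>t. ?G (?c t) $ i) has_derivative (\<lambda>t. D (t *\<^sub>R axis j 1) $ i)) (at 0 within S)"
    unfolding o_def by (rule bounded_linear.has_derivative[OF bounded_linear_vec_nth])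
  moreover have "(\<lambda>t. ?G (?c t) $ i) = (\<lambda>t. g i (q $ i))"
    using \<open>i \<noteq> j\<close> by (simp add: axis_def)
  moreover have "D (t *\<^sub>R axis j 1) $ i = t *\<^sub>R (D (axis j 1) $ i)" for t
    using has_derivative_linear[OF deriv] by (simp add: linear_scale)
  ultimately have "((\<lambda>t. g i (q $ i)) has_vector_derivative D (axis j 1) $ i) (at 0 within S)"
    by (simp add: has_vector_derivative_def)
  moreover have "((\<lambda>t. g i (q $ i)) has_vector_derivative 0) (at 0 within S)"
    by (rule has_vector_derivative_const)
  moreover have "at 0 within S \<noteq> bot"
    using pos by (simp add: S_def trivial_limit_within islimpt_Ico)
  ultimately show ?thesis
    by (metis vector_derivative_unique_within)
qed

lemma matrix_inv_left:
  fixes A :: "'a::field^'n^'n"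
  assumes "invertible A"
  shows "matrix_inv A ** A = mat 1"
  using someI_ex[OF assms[unfolded invertible_def]] by (simp add: matrix_inv_def)

lemma matrix_inv_unique:
  fixes A B :: "'a::field^'n^'n"
  assumes "A ** B = mat 1"
  shows "matrix_inv A = B"
proof -
  have "matrix_inv A ** A = mat 1"
    using assms by (intro matrix_inv_left) (auto simp: invertible_right_inverse)
  then show ?thesis
    using assms by (metis matrix_mul_assoc matrix_mul_lid matrix_mul_rid)
qed

text \<open>With \<open>H\<close> and \<open>K\<close> the derivatives of the conjugacy at
  \<open>p\<close> and of its inverse at \<open>h p\<close>, the product map has derivative H A K at
  \<open>h p\<close>, which is diagonal. Since \<open>K\<close> inverts \<open>H\<close>, this
  diagonalizes \<open>A\<close>.\<close>

lemma diagonalizable_derivative_at_fixed_point: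
  fixes A :: "real^2^2"
  assumes p: "p \<in> interior unit_cube" and "f p = p"
    and deriv_f: "(f has_derivative (*v) A) (at p)"
    and f_in: "\<And>x. x \<in> unit_cube \<Longrightarrow> f x \<in> unit_cube"
    and conj: "C1_conjugate_to_rotation_product f"
  shows "diagonalizable A"
proof -
  let ?C = "unit_cube :: (real^2) set"
  obtain h g1 g2 where h: "C1_diffeomorphism ?C ?C h"
    and G: "\<And>y. y \<in> ?C \<Longrightarrow> h (f (inv_into ?C h y)) = vector [g1 (y $ 1), g2 (y $ 2)]"
    using conj unfolding C1_conjugate_to_rotation_product_def by blast
  define k where "k = inv_into ?C h"
  define q where "q = h p"
  have pC: "p \<in> ?C"
    using p interior_subset by blast
  have bij: "bij_betw h ?C ?C"
    using h by (simp add: C1_diffeomorphism_def)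
  then have qC: "q \<in> ?C" and kh: "\<And>x. x \<in> ?C \<Longrightarrow> k (h x) = x"
    and kC: "\<And>y. y \<in> ?C \<Longrightarrow> k y \<in> ?C" and hC: "\<And>x. x \<in> ?C \<Longrightarrow> h x \<in> ?C"
    using pC by (auto simp: q_def k_def bij_betw_def inv_into_into)
  have kq: "k q = p"
    using kh pC by (simp add: q_def)
  obtain H where H: "(h has_derivative H) (at p within ?C)"
    using h pC unfolding C1_diffeomorphism_def C1_on_def by blast
  obtain K where K: "(k has_derivative K) (at q within ?C)"
    using h qC unfolding C1_diffeomorphism_def C1_on_def k_def by blast
  have linH: "linear H" and linK: "linear K"
    using H K by (auto intro: has_derivative_linear)

  have "((k \<circ> h) has_derivative (K \<circ> H)) (at p within ?C)"
    using hC by (intro diff_chain_within H)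
      (auto simp flip: q_def intro: has_derivative_subset[OF K])
  then have "((\<lambda>x. x) has_derivative (K \<circ> H)) (at p within ?C)"
    using kh pC by (rule_tac has_derivative_transform[where f = "k \<circ> h"]) auto
  \<comment> \<open>Both sides are derivatives of the identity within the cube; they agree because
    \<open>p\<close> is interior, whereas \<open>q\<close> might be a boundary point.\<close>
  then have KH: "K \<circ> H = (\<lambda>x. x)"
    using p by (metis at_within_interior has_derivative_ident has_derivative_unique)

  have "((f \<circ> k) has_derivative ((*v) A \<circ> K)) (at q within ?C)"
    by (intro diff_chain_within K) (simp add: kq has_derivative_at_withinI deriv_f)
  moreover have "(h has_derivative H) (at ((f \<circ> k) q) within (f \<circ> k) ` ?C)"
    using kC f_in by (auto simp: kq \<open>f p = p\<close> intro!: has_derivative_subset[OF H])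
  ultimately have "((h \<circ> (f \<circ> k)) has_derivative (H \<circ> ((*v) A \<circ> K))) (at q within ?C)"
    by (rule diff_chain_within)
  then have "((\<lambda>y. \<chi> i. (if i = 1 then g1 else g2) (y $ i)) has_derivative (H \<circ> ((*v) A \<circ> K)))
      (at q within ?C)"
    using qC G by (rule_tac has_derivative_transform) (auto simp: k_def vec_eq_iff forall_2)
  then have off_diag: "H (A *v K (axis j 1)) $ i = 0" if "i \<noteq> j" for i j
    using diagonal_derivative_of_product_map[OF qC _ that] by (auto simp: o_def)

  define P where "P = matrix K"
  define Q where "Q = matrix H"
  have PQ: "P ** Q = mat 1"
    using matrix_compose[OF linH linK] KH by (simp add: P_def Q_def matrix_id_mat_1 flip: id_def)
  \<comment> \<open>For square matrices a one-sided inverse is two-sided.\<close>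
  then have QP: "Q ** P = mat 1"
    by (rule matrix_left_right_inverse[THEN iffD1])
  have "invertible P" and inv: "matrix_inv P = Q"
    using PQ QP by (auto simp: invertible_def matrix_inv_unique)
  moreover have "(Q ** A ** P) $ i $ j = 0" if "i \<noteq> j" for i j
  proof -
    have "(Q ** A ** P) $ i $ j = ((Q ** A ** P) *v axis j 1) $ i"
      by (simp add: matrix_vector_mult_basis column_def)
    also have "\<dots> = H (A *v K (axis j 1)) $ i"
      using linH linK by (simp add: P_def Q_def matrix_works flip: matrix_vector_mul_assoc)
    finally show ?thesis
      using off_diag[OF that] by simp
  qed
  moreover have "P ** (Q ** A ** P) ** matrix_inv P = A"
  proof -
    have "P ** (Q ** A ** P) ** Q = (P ** Q) ** A ** (P ** Q)"
      by (simp add: matrix_mul_assoc)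
    then show ?thesis
      by (simp add: inv PQ)
  qed
  ultimately show ?thesis
    unfolding diagonalizable_def by metis
qed

section \<open>The Jordan block and its fixed points\<close>

definition jordan_block :: "real^2^2" where
  "jordan_block = vector [vector [-1/4, -1/4], vector [0, -1/4]]"

lemma jordan_block_mult:
  "(jordan_block *v x) $ 1 = - (x $ 1 + x $ 2) / 4" "(jordan_block *v x) $ 2 = - (x $ 2) / 4"
  by (simp_all add: jordan_block_def matrix_vector_mult_def sum_2)

lemma invertible_jordan_block: "invertible jordan_block"
  by (simp add: invertible_det_nz det_2 jordan_block_def)

text \<open>The norm is bounded by the larger absolute row sum, 1/4 + 1/4 for the first row.\<close>

lemma inf_opnorm_jordan_block: "inf_opnorm jordan_block < 1"
proof -
  have "infnorm (jordan_block *v x) / infnorm x \<le> 1/2" if "x \<noteq> 0" for x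
  proof -
    have "infnorm (jordan_block *v x) \<le> 1/2 * infnorm x"
      using abs_triangle_ineq4[of "- x $ 1" "x $ 2"] by (auto simp: infnorm_2 jordan_block_mult max_def)
    then show ?thesis
      using that by (simp add: pos_divide_le_eq infnorm_pos_lt)
  qed
  moreover have "- {0 :: real^2} \<noteq> {}"
    using one_neq_zero by blast
  ultimately have "inf_opnorm jordan_block \<le> 1/2"
    unfolding inf_opnorm_def by (intro cSUP_least) auto
  then show ?thesis
    by simp
qed

text \<open>The columns of a diagonalizing \<open>P\<close> would be eigenvectors. Every eigenvector
  of the block has second coordinate 0, so \<open>P\<close> would have a zero row.\<close>

lemma not_diagonalizable_jordan_block: "\<not> diagonalizable jordan_block"
proof
  assume "diagonalizable jordan_block"
  then obtain P D :: "real^2^2" where P: "invertible P"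
    and D: "\<And>i j. i \<noteq> j \<Longrightarrow> D $ i $ j = 0" and J: "jordan_block = P ** D ** matrix_inv P"
    unfolding diagonalizable_def by blast
  have "jordan_block ** P = P ** D ** (matrix_inv P ** P)"
    by (simp add: J matrix_mul_assoc)
  then have JP: "jordan_block ** P = P ** D"
    using P by (simp add: matrix_inv_left)
  have "P $ 2 $ j = 0" for j
  proof -
    have "(jordan_block *v column j P) $ i = D $ j $ j * P $ i $ j" for i
    proof -
      have "(jordan_block *v column j P) $ i = (jordan_block ** P) $ i $ j"
        by (simp add: matrix_vector_mult_def matrix_matrix_mult_def column_def)
      also have "\<dots> = D $ j $ j * P $ i $ j"
        unfolding JP using D[of 1 2] D[of 2 1] exhaust_2[of j]
        by (auto simp: matrix_matrix_mult_def sum_2)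
      finally show ?thesis .
    qed
    from this[of 1] this[of 2]
    have eq1: "- (P $ 1 $ j + P $ 2 $ j) / 4 = D $ j $ j * P $ 1 $ j"
      and eq2: "- (P $ 2 $ j) / 4 = D $ j $ j * P $ 2 $ j"
      by (simp_all add: jordan_block_mult column_def)
    show ?thesis
    proof (rule ccontr)
      assume nz: "P $ 2 $ j \<noteq> 0"
      \<comment> \<open>A nonzero second coordinate forces the eigenvalue -1/4, and then
        \<open>eq1\<close> makes that coordinate vanish.\<close>
      have "P $ 2 $ j * (D $ j $ j + 1/4) = 0"
        using eq2 by (simp add: algebra_simps)
      with nz have "D $ j $ j = -1/4"
        by simp
      then show False
        using eq1 nz by simp
    qed
  qed
  then have "det P = 0"
    by (simp add: det_2)
  with P show False
    by (simp add: invertible_det_nz)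
qed

lemma jordan_block_fixed_point:
  fixes b :: "real^2"
  obtains p m where "p \<in> interior unit_cube"
    and "\<And>i. (jordan_block *v p + b) $ i = p $ i + of_int (m i)"
proof -
  \<comment> \<open>The factor 4/5 is 1/(1 + 1/4), from solving x = -x/4 + z - m. Subtracting the
    ceiling minus one leaves a number in (0,1], which the factor brings strictly inside (0,1);
    subtracting the floor could give 0, on the boundary.\<close>
  have unit: "0 < (z - of_int (\<lceil>z\<rceil> - 1)) * 4/5" "(z - of_int (\<lceil>z\<rceil> - 1)) * 4/5 < 1" for z :: real
    using ceiling_correct[of z] le_of_int_ceiling[of z] unfolding of_int_diff of_int_1 by (auto, linarith)
  \<comment> \<open>The second equation involves only \<open>x2\<close>; the first is then solved
    for \<open>x1\<close> with \<open>x2\<close> known.\<close>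
  define m2 where "m2 = \<lceil>b $ 2\<rceil> - 1"
  define x2 where "x2 = (b $ 2 - of_int m2) * 4/5"
  define m1 where "m1 = \<lceil>b $ 1 - x2 / 4\<rceil> - 1"
  define x1 where "x1 = (b $ 1 - x2 / 4 - of_int m1) * 4/5"
  have "0 < x2" "x2 < 1"
    unfolding x2_def m2_def by (rule unit)+
  have "0 < x1" "x1 < 1"
    unfolding x1_def m1_def by (rule unit)+
  show thesis
  proof
    show "(vector [x1, x2] :: real^2) \<in> interior unit_cube"
    proof (rule interior_unit_cubeI)
      fix i :: 2
      show "0 < (vector [x1, x2] :: real^2) $ i" "(vector [x1, x2] :: real^2) $ i < 1"
        using exhaust_2[of i] \<open>0 < x2\<close> \<open>x2 < 1\<close> \<open>0 < x1\<close> \<open>x1 < 1\<close> by auto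
    qed
    show "(jordan_block *v vector [x1, x2] + b) $ i
        = (vector [x1, x2] :: real^2) $ i + of_int (if i = 1 then m1 else m2)" for i
      using exhaust_2[of i] by (auto simp: jordan_block_mult x1_def x2_def field_simps)
  qed
qed

theorem theorem2:
  "\<exists>(A :: real^2^2) (U :: (real^2) set).
     invertible A \<and> inf_opnorm A < 1 \<and> \<not> diagonalizable A \<and>
     - U \<in> null_sets lebesgue \<and>
     (\<forall>b\<in>U. \<not> C1_conjugate_to_rotation_product (affine_mod1 A b))"
proof -
  have "\<not> C1_conjugate_to_rotation_product (affine_mod1 jordan_block b)" for b
  proof -
    obtain p m where p: "p \<in> interior unit_cube"
      and m: "\<And>i. (jordan_block *v p + b) $ i = p $ i + of_int (m i)"
      using jordan_block_fixed_point[of b] by blast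
    show ?thesis
      using diagonalizable_derivative_at_fixed_point[OF p
          affine_mod1_has_derivative_at_fixed_point[OF p m] affine_mod1_in_unit_cube]
        not_diagonalizable_jordan_block by blast
  qed
  \<comment> \<open>The fixed point exists for every \<open>b\<close>, so \<open>U\<close> is the
    whole plane and its complement is empty.\<close>
  then show ?thesis
    using invertible_jordan_block inf_opnorm_jordan_block not_diagonalizable_jordan_block
    by (intro exI[of _ jordan_block] exI[of _ UNIV]) simp
qed

end
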